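(* Let $q$ be a positive even integer. Then $ex(q^2+q,C_4) \leq \frac{1}{2}q(q+1)^2-q$; that is, every graph on $q^2+q$ vertices that contains no cycle of length $4$ as a subgraph has at most $\frac{1}{2}q(q+1)^2-q$ edges.
   Context: For a positive integer $n$ and a graph $H$, $ex(n,H)$ denotes the largest number of edges in a simple graph on $n$ vertices that does not contain $H$ as a subgraph. $C_4$ denotes the cycle of length $4$. *)

theory Defs
  imports Complex_Main
begin

type_synonym 'a graph = "'a set \<times> 'a set set"

definition simple_graph :: "'a graph \<Rightarrow> bool" where
  "simple_graph G \<longleftrightarrow> finite (fst G) \<and> snd G \<subseteq> {e. e \<subseteq> fst G \<and> card e = 2}"

text \<open>Containment as a not necessarily induced subgraph: some injective map of vertices
  sends every edge of \<open>H\<close> to an edge of \<open>G\<close>.\<close>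

definition contains_subgraph :: "'a graph \<Rightarrow> 'b graph \<Rightarrow> bool" where
  "contains_subgraph G H \<longleftrightarrow>
    (\<exists>f. inj_on f (fst H) \<and> f ` fst H \<subseteq> fst G \<and> (\<forall>e \<in> snd H. f ` e \<in> snd G))"

text \<open>The cycle of length \<open>k\<close>, meant for \<open>k \<ge> 3\<close>.\<close>

definition cycle_graph :: "nat \<Rightarrow> nat graph" where
  "cycle_graph k = ({..<k}, {{i, Suc i mod k} | i. i < k})"

text \<open>Every simple graph on \<open>n\<close> vertices is isomorphic to one with vertex set \<open>{..<n}\<close>, so
  the maximum ranges over edge sets on that vertex set. It is unspecified when there is no
  \<open>H\<close>-free graph on \<open>n\<close> vertices, which requires \<open>H\<close> to be edgeless.\<close>

definition ex :: "nat \<Rightarrow> 'b graph \<Rightarrow> nat" where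
  "ex n H = Max {card E | E. simple_graph ({..<n}, E) \<and> \<not> contains_subgraph ({..<n}, E) H}"

end

theory Submission
  imports Defs
begin

text \<open>Call \<open>x v = q + 1 - deg v\<close> the deficiency of \<open>v\<close>. Counting paths of length two from \<open>v\<close>
  bounds the total deficiency of its neighbours from below, and for odd degree the bound improves
  by one, since equality would force a perfect matching on the neighbourhood. So a vertex of degree
  \<open>q + 1\<close>, which is odd, sees total deficiency at least 2; summing over these vertices gives
  total deficiency greater than \<open>2q - 2\<close> when no degree exceeds \<open>q + 1\<close>, and the total
  deficiency is even.

  Suppose the total deficiency is at most \<open>2q - 2\<close>. Counting pairs of non-neighbours of a vertex
  of large degree excludes degrees above \<open>q + 2\<close> and bounds the size of the set \<open>A\<close> of vertices
  of degree \<open>q + 2\<close>. If \<open>P\<close> is the set of vertices of degree at most \<open>q\<close>, the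
  summation above shows that at least \<open>(q - 1) |A| + 4\<close> edges join \<open>A\<close> to \<open>P\<close>. As
  \<open>|P| \<le> |A| + 2q - 2\<close>, this is too many for a bipartite graph without 4-cycles.\<close>

section \<open>Pair counting and the integer inequalities\<close>

text \<open>Two different sets \<open>F w\<close> share at most one element, so their sets of
  ordered pairs of distinct elements are disjoint and all lie in that of \<open>B\<close>.
  Neighbourhoods in a graph without 4-cycles are such a family.\<close>

lemma sum_ordered_pairs_le:
  fixes F :: "'b \<Rightarrow> 'a set"
  assumes "finite A" "finite B" and sub: "\<And>w. w \<in> A \<Longrightarrow> F w \<subseteq> B"
    and uniq: "\<And>v w x y. \<lbrakk>v \<in> A; w \<in> A; v \<noteq> w; x \<in> F v; y \<in> F v; x \<in> F w; y \<in> F w\<rbrakk> \<Longrightarrow> x = y"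
  shows "(\<Sum>w\<in>A. int (card (F w)) * (int (card (F w)) - 1)) \<le> int (card B) * (int (card B) - 1)"
proof -
  have off: "finite {(x, y). x \<in> X \<and> y \<in> X \<and> x \<noteq> y} \<and>
      int (card {(x, y). x \<in> X \<and> y \<in> X \<and> x \<noteq> y}) = int (card X) * (int (card X) - 1)"
    if "finite X" for X :: "'a set"
  proof -
    have eq: "{(x, y). x \<in> X \<and> y \<in> X \<and> x \<noteq> y} = (SIGMA x:X. X - {x})"
      by auto
    have "int (card (SIGMA x:X. X - {x})) = (\<Sum>x\<in>X. int (card (X - {x})))"
      using that by simp
    also have "\<dots> = (\<Sum>x\<in>X. int (card X) - 1)"
    proof (rule sum.cong)
      fix x assume "x \<in> X"
      then have "card X = Suc (card (X - {x}))"
        using that by (metis card.remove)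
      then show "int (card (X - {x})) = int (card X) - 1" by simp
    qed simp
    finally show ?thesis using that by (simp add: eq)
  qed
  define D where "D X = {(x, y). x \<in> X \<and> y \<in> X \<and> x \<noteq> y}" for X :: "'a set"
  have fin: "finite (F w)" if "w \<in> A" for w
    using sub[OF that] assms(2) finite_subset by blast
  have "(\<Sum>w\<in>A. int (card (F w)) * (int (card (F w)) - 1)) = (\<Sum>w\<in>A. int (card (D (F w))))"
    using off fin by (intro sum.cong) (auto simp: D_def)
  also have "\<dots> = int (card (\<Union>w\<in>A. D (F w)))"
  proof -
    have "card (\<Union>w\<in>A. D (F w)) = (\<Sum>w\<in>A. card (D (F w)))"
    proof (rule card_UN_disjoint)
      show "\<forall>w\<in>A. finite (D (F w))" using off fin by (simp add: D_def)
      show "\<forall>v\<in>A. \<forall>w\<in>A. v \<noteq> w \<longrightarrow> D (F v) \<inter> D (F w) = {}"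
        using uniq by (auto simp: D_def)
    qed fact
    then show ?thesis by simp
  qed
  also have "\<dots> \<le> int (card (D B))"
  proof -
    have "(\<Union>w\<in>A. D (F w)) \<subseteq> D B" using sub by (fastforce simp: D_def)
    moreover have "finite (D B)" using off[OF assms(2)] by (simp add: D_def)
    ultimately show ?thesis by (simp add: card_mono)
  qed
  also have "\<dots> = int (card B) * (int (card B) - 1)"
    using off[OF assms(2)] by (simp add: D_def)
  finally show ?thesis .
qed

lemma int_mult_succ_nonneg: "0 \<le> (t::int) * (t + 1)"
  by (cases "0 \<le> t") (auto simp: zero_le_mult_iff)

text \<open>Expands the pair count around \<open>m = q\<close>. The last term is a product of
  consecutive integers, hence nonnegative, and dropping it leaves a minorant linear in
  \<open>m\<close>, exact at \<open>q - 1\<close> and \<open>q\<close>.\<close>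

lemma pair_excess:
  fixes m q :: int
  shows "m * (m - 1) = q * (q - 1) + 2 * (q - 1) * (m - q) + (m - q) * (m - q + 1)"
  by algebra

text \<open>Serves to exclude degrees \<open>q + 1 + k\<close> with \<open>k \<ge> 2\<close>:
  \<open>S\<close> stands for the total deficiency, \<open>k \<le> q\<^sup>2 - 2\<close> says that
  the degree is less than the number of vertices, and \<open>le\<close> is the count of pairs of
  non-neighbours.\<close>

lemma large_degree_arith:
  fixes q k S :: int
  assumes "2 \<le> q" "2 \<le> k" "k \<le> q\<^sup>2 - 2" "S \<le> 2 * q - 2"
    and le: "(q\<^sup>2 + q - 1) * (q * (q - 1)) - 2 * (q - 1) * (S + k)
      \<le> (q\<^sup>2 - 1 - k) * (q\<^sup>2 - 1 - k - 1)"
  shows False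
proof -
  have "(q - 1) * (S + k) \<le> (q - 1) * (2 * q - 2 + k)"
    using assms by (intro mult_left_mono) auto
  then have "(q\<^sup>2 + q - 1) * (q * (q - 1)) - 2 * (q - 1) * (2 * q - 2 + k)
      \<le> (q\<^sup>2 - 1 - k) * (q\<^sup>2 - 1 - k - 1)"
    using le by linarith
  then have f: "(k - 2) * (q\<^sup>2 - 2 - k) + (k - 2) * (q\<^sup>2 - 2 * q - 1) + q\<^sup>2 + 5 * q - 12 \<le> 0"
    by (simp add: algebra_simps power2_eq_square)
  have pos: "0 \<le> (k - 2) * (q\<^sup>2 - 2 - k)"
    using assms by simp
  show False
  \<comment> \<open>The factor \<open>q\<^sup>2 - 2 * q - 1\<close> is negative at
    \<open>q = 2\<close>, where the bounds leave only \<open>k = 2\<close>.\<close>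
  proof (cases "q = 2")
    case True
    then show False using f assms by simp
  next
    case False
    then have "3 \<le> q" using assms by simp
    then have "3 * q \<le> q * q" by simp
    then have "0 \<le> (k - 2) * (q\<^sup>2 - 2 * q - 1)"
      using assms \<open>3 \<le> q\<close> by (intro mult_nonneg_nonneg) (auto simp: power2_eq_square)
    then show False using f pos \<open>3 * q \<le> q * q\<close> \<open>3 \<le> q\<close> by (simp add: power2_eq_square)
  qed
qed

text \<open>Here \<open>a\<close> and \<open>p\<close> are the sizes of \<open>A\<close> and
  \<open>P\<close>, and \<open>e\<close> is the number of edges joining them. The pairs inside
  \<open>A\<close> force \<open>a\<close> to be large, \<open>a_le\<close> bounds it from above, and
  in the remaining range \<open>pairs_P\<close> fails because its left side is cubic in
  \<open>q\<close> already at the smallest \<open>a\<close>.\<close>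

lemma degree_class_arith:
  fixes q a p e :: int
  assumes "2 \<le> q" "even q" "0 \<le> a" "0 \<le> p"
    and p: "p \<le> a + 2 * q - 2"
    and e_ge: "(q - 1) * a + 4 \<le> e"
    and e_le: "e \<le> (q + 2) * a"
    and pairs_A: "2 * e \<le> 2 * p + a * (a - 1)"
    and a_le: "1 \<le> a \<Longrightarrow> 2 * (a - 1) \<le> q\<^sup>2 - 7 * q + 8"
    and pairs_P: "a * ((q - 1) * (q - 2)) + 2 * (q - 1) * (e - (q - 1) * a) \<le> p * (p - 1)"
  shows False
proof -
  have "3 * a \<ge> 4" using e_ge e_le by (simp add: algebra_simps)
  then have a2: "2 \<le> a" by linarith
  have "a * (a - 1) + 2 * (a + 2 * q - 2) \<ge> 2 * ((q - 1) * a + 4)"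
    using p e_ge pairs_A by (simp add: algebra_simps)
  then have "0 < (a - 2) * (a - (2 * q - 5))"
    by (simp add: algebra_simps)
  then have L: "2 * q - 4 \<le> a"
    using a2 by (simp add: zero_less_mult_iff)
  have a_up: "2 * a \<le> q\<^sup>2 - 7 * q + 10" using a_le a2 by simp
  \<comment> \<open>For these \<open>q\<close> the bound \<open>a_up\<close> is incompatible with
    \<open>a2\<close> or \<open>L\<close>. From \<open>q = 10\<close> on the range is nonempty;
    writing \<open>q = r + 10\<close> makes the final polynomial have positive coefficients
    only.\<close>
  have "\<not> q \<le> 9"
  proof
    assume "q \<le> 9"
    then have "q = 2 \<or> q = 4 \<or> q = 6 \<or> q = 8"
      using \<open>2 \<le> q\<close> \<open>even q\<close> by presburger
    then show False using a_up L a2 \<open>0 < _\<close> by auto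
  qed
  then obtain r where r: "q = r + 10" "0 \<le> r"
    using that[of "q - 10"] by simp
  define m where "m = 2 * q - 2"
  have "p * (p - 1) \<le> (a + m) * (a + m - 1)"
  proof (cases "p = 0")
    case True
    then show ?thesis using a2 \<open>2 \<le> q\<close> by (simp add: m_def)
  next
    case False
    then show ?thesis using assms by (intro mult_mono) (auto simp: m_def)
  qed
  moreover have "2 * (q - 1) * 4 \<le> 2 * (q - 1) * (e - (q - 1) * a)"
    using e_ge \<open>2 \<le> q\<close> by (intro mult_left_mono) auto
  ultimately have g: "a * ((q - 1) * (q - 2)) + 8 * (q - 1) \<le> (a + m) * (a + m - 1)"
    using pairs_P by linarith
  \<comment> \<open>The product is twice the change in the left minus the right side of
    \<open>g\<close>, without the constant \<open>8 * (q - 1)\<close>, as \<open>a\<close> grows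
    from \<open>2 * q - 4\<close>. Its sign carries \<open>g\<close> over to the endpoint
    \<open>a = 2 * q - 4\<close>.\<close>
  have "0 \<le> (a - (2 * q - 4)) * (2 * ((q - 1) * (q - 2)) - 2 * (a + (2 * q - 4) + 2 * m - 1))"
  proof (rule mult_nonneg_nonneg)
    have "0 \<le> r * r + 9 * r" using r by simp
    then have "q\<^sup>2 - 7 * q + 10 + 2 * (2 * q - 4) + 4 * m - 2 \<le> 2 * ((q - 1) * (q - 2))"
      by (simp add: r m_def algebra_simps power2_eq_square)
    then show "0 \<le> 2 * ((q - 1) * (q - 2)) - 2 * (a + (2 * q - 4) + 2 * m - 1)"
      using a_up by (simp add: algebra_simps)
  qed (use L in simp)
  then have "2 * ((2 * q - 4) * ((q - 1) * (q - 2)) + 8 * (q - 1))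
      \<le> 2 * ((2 * q - 4 + m) * (2 * q - 4 + m - 1))"
    using g by (simp add: algebra_simps)
  then have "2 * (r * (r * r)) + 34 * (r * r) + 156 * r + 102 \<le> 0"
    by (simp add: r m_def algebra_simps)
  moreover have "0 \<le> r * (r * r)" "0 \<le> r * r" using r by auto
  ultimately show False using r by linarith
qed

section \<open>Neighbourhoods and double counting in graphs without 4-cycles\<close>

locale C4_free_graph =
  fixes V :: "'a set" and E :: "'a set set"
  assumes simple: "simple_graph (V, E)"
    and C4_free: "\<not> contains_subgraph (V, E) (cycle_graph 4)"
begin

definition nbrs :: "'a \<Rightarrow> 'a set" where
  "nbrs v = {w. {v, w} \<in> E}"

lemma finite_V: "finite V"
  using simple by (simp add: simple_graph_def)

lemma edge: "e \<in> E \<Longrightarrow> e \<subseteq> V \<and> card e = 2"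
  using simple by (auto simp: simple_graph_def)

lemma finite_E: "finite E"
  using finite_V edge by (meson PowI finite_Pow_iff finite_subset subsetI)

lemma nbrs_sub: "nbrs v \<subseteq> V"
  using edge by (auto simp: nbrs_def)

lemma finite_nbrs: "finite (nbrs v)"
  using nbrs_sub finite_V finite_subset by blast

lemma nbrs_sym: "w \<in> nbrs v \<longleftrightarrow> v \<in> nbrs w"
  by (simp add: nbrs_def insert_commute)

lemma not_nbr_self: "v \<notin> nbrs v"
  using edge[of "{v}"] by (auto simp: nbrs_def)

text \<open>Otherwise \<open>u\<close>, \<open>x\<close>, \<open>w\<close>, \<open>y\<close> in this
  order would be a 4-cycle. All later arguments use the absence of 4-cycles through this
  fact.\<close>

lemma common_nbr_unique:
  assumes "u \<noteq> w" "x \<in> nbrs u" "x \<in> nbrs w" "y \<in> nbrs u" "y \<in> nbrs w"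
  shows "x = y"
proof (rule ccontr)
  assume "x \<noteq> y"
  define f where "f i = (if i = 0 then u else if i = 1 then x else if i = 2 then w else y)" for i :: nat
  have less4: "i < 4 \<longleftrightarrow> i = 0 \<or> i = 1 \<or> i = 2 \<or> i = 3" for i :: nat
    by auto
  have ne: "u \<noteq> x" "w \<noteq> x" "u \<noteq> y" "w \<noteq> y"
    using assms not_nbr_self by auto
  have E: "{u, x} \<in> E" "{x, w} \<in> E" "{w, y} \<in> E" "{y, u} \<in> E"
    using assms by (auto simp: nbrs_def insert_commute)
  have "inj_on f {..<4}"
    using ne \<open>u \<noteq> w\<close> \<open>x \<noteq> y\<close> by (auto simp: inj_on_def f_def less4)
  moreover have "f ` {..<4} \<subseteq> V"
    using E edge by (auto simp: f_def)
  moreover have "f ` {i, Suc i mod 4} \<in> E" if "i < 4" for i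
    using that E by (auto simp: less4 f_def insert_commute)
  ultimately have "contains_subgraph (V, E) (cycle_graph 4)"
    unfolding contains_subgraph_def cycle_graph_def by (intro exI[of _ f]) auto
  then show False using C4_free by simp
qed

lemma card_common_nbrs_le_1: "u \<noteq> w \<Longrightarrow> card (nbrs u \<inter> nbrs w) \<le> 1"
  using common_nbr_unique finite_nbrs by (auto simp: card_le_Suc0_iff_eq)

text \<open>Stated for induced subgraphs because it is applied to a neighbourhood, for parity, as
  well as to all of \<open>V\<close>.\<close>

lemma handshake:
  assumes "X \<subseteq> V"
  shows "(\<Sum>v\<in>X. card (nbrs v \<inter> X)) = 2 * card {e \<in> E. e \<subseteq> X}"
proof -
  define F where "F = {e \<in> E. e \<subseteq> X}"
  have finX: "finite X" and finF: "finite F"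
    using assms finite_V finite_E finite_subset by (auto simp: F_def)
  have "card (nbrs v \<inter> X) = card {e \<in> F. v \<in> e}" if "v \<in> X" for v
  proof (rule bij_betw_same_card)
    show "bij_betw (\<lambda>w. {v, w}) (nbrs v \<inter> X) {e \<in> F. v \<in> e}"
    proof (rule bij_betw_imageI)
      show "inj_on (\<lambda>w. {v, w}) (nbrs v \<inter> X)"
        by (auto simp: inj_on_def doubleton_eq_iff)
      show "(\<lambda>w. {v, w}) ` (nbrs v \<inter> X) = {e \<in> F. v \<in> e}"
      proof
        show "(\<lambda>w. {v, w}) ` (nbrs v \<inter> X) \<subseteq> {e \<in> F. v \<in> e}"
          using that by (auto simp: F_def nbrs_def)
        show "{e \<in> F. v \<in> e} \<subseteq> (\<lambda>w. {v, w}) ` (nbrs v \<inter> X)"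
        proof
          fix e assume e: "e \<in> {e \<in> F. v \<in> e}"
          then have "card e = 2" using edge by (auto simp: F_def)
          then obtain w where "e = {v, w}"
            using e by (auto simp: card_2_iff)
          then show "e \<in> (\<lambda>w. {v, w}) ` (nbrs v \<inter> X)"
            using e by (auto simp: F_def nbrs_def)
        qed
      qed
    qed
  qed
  then have "(\<Sum>v\<in>X. card (nbrs v \<inter> X)) = (\<Sum>v\<in>X. card {e \<in> F. v \<in> e})"
    by simp
  also have "\<dots> = 2 * card F"
  proof (rule sum_multicount[OF finX finF])
    show "\<forall>e\<in>F. card {v \<in> X. v \<in> e} = 2"
    proof
      fix e assume "e \<in> F"
      then have "{v \<in> X. v \<in> e} = e" "card e = 2" using edge by (auto simp: F_def)
      then show "card {v \<in> X. v \<in> e} = 2" by simp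
    qed
  qed
  finally show ?thesis by (simp add: F_def)
qed

lemma sum_nbrs_swap:
  fixes f :: "'a \<Rightarrow> int"
  assumes "X \<subseteq> V" "Y \<subseteq> V"
  shows "(\<Sum>v\<in>X. \<Sum>u\<in>nbrs v \<inter> Y. f u) = (\<Sum>u\<in>Y. int (card (nbrs u \<inter> X)) * f u)"
proof -
  have fin: "finite X" "finite Y" using assms finite_V finite_subset by auto
  have "(\<Sum>v\<in>X. \<Sum>u\<in>nbrs v \<inter> Y. f u) = (\<Sum>v\<in>X. \<Sum>u\<in>{u \<in> Y. u \<in> nbrs v}. f u)"
    by (intro sum.cong) auto
  also have "\<dots> = (\<Sum>u\<in>Y. \<Sum>v\<in>{v \<in> X. u \<in> nbrs v}. f u)"
    using fin by (rule sum.swap_restrict)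
  also have "\<dots> = (\<Sum>u\<in>Y. int (card (nbrs u \<inter> X)) * f u)"
  proof (rule sum.cong)
    fix u
    have "{v \<in> X. u \<in> nbrs v} = nbrs u \<inter> X" using nbrs_sym by auto
    then show "(\<Sum>v\<in>{v \<in> X. u \<in> nbrs v}. f u) = int (card (nbrs u \<inter> X)) * f u" by simp
  qed simp
  finally show ?thesis .
qed

lemma card_nbrs_swap:
  assumes "X \<subseteq> V" "Y \<subseteq> V"
  shows "(\<Sum>v\<in>X. int (card (nbrs v \<inter> Y))) = (\<Sum>u\<in>Y. int (card (nbrs u \<inter> X)))"
  using sum_nbrs_swap[OF assms, of "\<lambda>_. 1"] by simp

text \<open>Equality in the trivial bound means that every other vertex has exactly one common neighbour
  with \<open>v\<close>; then the graph induced on the neighbourhood of \<open>v\<close> is a perfect matching.\<close>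

lemma sum_nbr_degrees_le:
  assumes v: "v \<in> V"
  shows "(\<Sum>u\<in>nbrs v. int (card (nbrs u)))
    \<le> int (card V) + int (card (nbrs v)) - 1 - (if odd (card (nbrs v)) then 1 else 0)"
proof -
  define c where "c w = card (nbrs w \<inter> nbrs v)" for w
  have c1: "c w \<le> 1" if "w \<in> V - {v}" for w
    using that card_common_nbrs_le_1 by (auto simp: c_def)
  have cardV: "card V = Suc (card (V - {v}))"
    using v finite_V by (metis card.remove)
  have "(\<Sum>u\<in>nbrs v. int (card (nbrs u))) = (\<Sum>u\<in>nbrs v. int (card (nbrs u \<inter> V)))"
    using nbrs_sub by (simp add: Int_absorb2)
  \<comment> \<open>Walks of length two from \<open>v\<close> are grouped by their last vertex
    \<open>w\<close>; those returning to \<open>v\<close> number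
    \<open>card (nbrs v)\<close>.\<close>
  also have "\<dots> = (\<Sum>w\<in>V. int (c w))"
    using card_nbrs_swap[of V "nbrs v"] nbrs_sub by (simp add: c_def)
  also have "\<dots> = int (card (nbrs v)) + (\<Sum>w\<in>V - {v}. int (c w))"
    using v finite_V by (simp add: sum.remove c_def)
  finally have total: "(\<Sum>u\<in>nbrs v. int (card (nbrs u)))
    = int (card (nbrs v)) + (\<Sum>w\<in>V - {v}. int (c w))" .
  have le: "(\<Sum>w\<in>V - {v}. int (c w)) \<le> int (card V) - 1"
    using sum_mono[of "V - {v}" "\<lambda>w. int (c w)" "\<lambda>_. 1"] c1 cardV by simp
  have "(\<Sum>w\<in>V - {v}. int (c w)) \<noteq> int (card V) - 1" if odd: "odd (card (nbrs v))"
  proof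
    assume "(\<Sum>w\<in>V - {v}. int (c w)) = int (card V) - 1"
    then have "(\<Sum>w\<in>V - {v}. 1 - int (c w)) = 0"
      using cardV by (simp add: sum_subtractf)
    then have "\<forall>w\<in>V - {v}. 1 - int (c w) = 0"
      using c1 finite_V by (subst (asm) sum_nonneg_eq_0_iff) auto
    then have "\<forall>w\<in>nbrs v. c w = 1"
      using nbrs_sub not_nbr_self by force
    then have "(\<Sum>w\<in>nbrs v. c w) = card (nbrs v)" by simp
    then show False
      using handshake[OF nbrs_sub, of v] odd unfolding c_def by (metis dvd_triv_left)
  qed
  then show ?thesis using total le by auto
qed

text \<open>Each \<open>w\<close> other than \<open>v\<close> has at most one neighbour in
  \<open>nbrs v\<close>, hence at least \<open>q - x w\<close> outside it. The pairs of such outside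
  neighbours are distinct for distinct \<open>w\<close> and lie in a set of size \<open>M\<close>.
  The linear minorant from \<open>pair_excess\<close> turns this into a bound on
  deficiencies.\<close>

lemma pairs_outside_nbrs:
  fixes q :: nat
  assumes q: "0 < q" and v: "v \<in> V"
  defines "x \<equiv> \<lambda>w. int q + 1 - int (card (nbrs w))"
    and "M \<equiv> int (card V) - int (card (nbrs v))"
  shows "(int (card V) - 1) * (int q * (int q - 1)) - 2 * (int q - 1) * (\<Sum>w\<in>V - {v}. x w)
      + 2 * int (card {w \<in> V - {v}. card (nbrs w) = q + 2}) \<le> M * (M - 1)"
proof -
  define m where "m w = int (card (nbrs w - nbrs v))" for w
  have fin: "finite (V - {v})" using finite_V by simp
  have point: "int q * (int q - 1) - 2 * (int q - 1) * x w
      + (if card (nbrs w) = q + 2 then 2 else 0) \<le> m w * (m w - 1)" if w: "w \<in> V - {v}" for w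
  proof -
    have "card (nbrs w) = card (nbrs w - nbrs v) + card (nbrs w \<inter> nbrs v)"
      using card_Diff_subset_Int[of "nbrs w" "nbrs v"] finite_nbrs
      by (metis Int_Diff_Un Int_Diff_disjoint add.commute card_Un_disjoint finite_Diff finite_Int)
    moreover have "card (nbrs w \<inter> nbrs v) \<le> 1" using w card_common_nbrs_le_1 by auto
    ultimately have m: "int q - x w \<le> m w" by (simp add: m_def x_def)
    then have "(int q - 1) * (- x w) \<le> (int q - 1) * (m w - int q)"
      using q by (intro mult_left_mono) auto
    \<comment> \<open>Degree \<open>q + 2\<close> means \<open>x w = - 1\<close>, so
      \<open>m w - q \<ge> 1\<close> and the term dropped elsewhere is at least 2.\<close>
    moreover have "(if card (nbrs w) = q + 2 then 2 else 0) \<le> (m w - int q) * (m w - int q + 1)"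
    proof (cases "card (nbrs w) = q + 2")
      case True
      then have "1 \<le> m w - int q" using m by (simp add: x_def)
      then show ?thesis using True mult_mono[of 1 "m w - int q" 2 "m w - int q + 1"] by simp
    qed (use int_mult_succ_nonneg in simp)
    ultimately show ?thesis using pair_excess[of "m w" "int q"] by linarith
  qed
  have "(\<Sum>w\<in>V - {v}. int q * (int q - 1) - 2 * (int q - 1) * x w
      + (if card (nbrs w) = q + 2 then 2 else 0)) \<le> (\<Sum>w\<in>V - {v}. m w * (m w - 1))"
    using point by (intro sum_mono) auto
  also have "\<dots> \<le> int (card (V - nbrs v)) * (int (card (V - nbrs v)) - 1)"
    unfolding m_def
  proof (rule sum_ordered_pairs_le)
    fix w w' y z
    assume "w \<noteq> w'" "y \<in> nbrs w - nbrs v" "z \<in> nbrs w - nbrs v"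
      "y \<in> nbrs w' - nbrs v" "z \<in> nbrs w' - nbrs v"
    then show "y = z" using common_nbr_unique[of w w' y z] by blast
  qed (use finite_V nbrs_sub in auto)
  also have "int (card (V - nbrs v)) = M"
    using nbrs_sub[of v] finite_V finite_nbrs
    by (simp add: M_def card_Diff_subset card_mono of_nat_diff)
  also have "(\<Sum>w\<in>V - {v}. int q * (int q - 1) - 2 * (int q - 1) * x w
      + (if card (nbrs w) = q + 2 then 2 else 0)) = int (card (V - {v})) * (int q * (int q - 1))
      - 2 * (int q - 1) * (\<Sum>w\<in>V - {v}. x w)
      + 2 * int (card {w \<in> V - {v}. card (nbrs w) = q + 2})"
    using fin by (simp add: sum.distrib sum_subtractf sum_distrib_left sum.If_cases Int_def)
  also have "int (card (V - {v})) = int (card V) - 1"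
    using v finite_V by (metis card.remove of_nat_Suc add_diff_cancel_left')
  finally show ?thesis .
qed

section \<open>Lower bound for the total deficiency\<close>

lemma deficiency_gt:
  fixes q :: nat
  assumes q: "0 < q" "even q" and cardV: "card V = q\<^sup>2 + q"
  defines "x \<equiv> \<lambda>w. int q + 1 - int (card (nbrs w))"
  shows "2 * int q - 2 < (\<Sum>w\<in>V. x w)"
proof (rule ccontr)
  define Q where "Q = int q"
  define S where "S = (\<Sum>w\<in>V. x w)"
  assume "\<not> 2 * int q - 2 < (\<Sum>w\<in>V. x w)"
  then have S: "S \<le> 2 * Q - 2" by (simp add: S_def Q_def)
  have Q2: "2 \<le> Q" "even Q" using q by (auto simp: Q_def elim: evenE)
  have n: "int (card V) = Q\<^sup>2 + Q" by (simp add: cardV Q_def)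
  have sum_rest: "(\<Sum>w\<in>V - {v}. x w) = S - x v" if "v \<in> V" for v
    using that finite_V by (simp add: S_def sum.remove)
  have count: "(Q\<^sup>2 + Q - 1) * (Q * (Q - 1)) - 2 * (Q - 1) * (S - x v)
      + 2 * int (card {w \<in> V - {v}. card (nbrs w) = q + 2})
      \<le> (Q\<^sup>2 - 1 + x v) * (Q\<^sup>2 - 1 + x v - 1)" if "v \<in> V" for v
  proof -
    have M: "Q\<^sup>2 + Q - int (card (nbrs v)) = Q\<^sup>2 - 1 + x v"
      by (simp add: x_def Q_def)
    show ?thesis
      using pairs_outside_nbrs[OF q(1) that, folded x_def Q_def, unfolded n sum_rest[OF that] M] .
  qed
  have max_deg: "card (nbrs v) \<le> q + 2" if v: "v \<in> V" for v
  proof (rule ccontr)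
    assume "\<not> card (nbrs v) \<le> q + 2"
    then have k2: "2 \<le> - x v" by (simp add: x_def)
    have "nbrs v \<subset> V" using nbrs_sub not_nbr_self v by blast
    then have "card (nbrs v) < card V" using finite_V by (simp add: psubset_card_mono)
    then have "int (card (nbrs v)) < Q\<^sup>2 + Q" using n by linarith
    then have "- x v \<le> Q\<^sup>2 - 2" by (simp add: x_def Q_def)
    moreover have "(Q\<^sup>2 + Q - 1) * (Q * (Q - 1)) - 2 * (Q - 1) * (S + (- x v))
      \<le> (Q\<^sup>2 - 1 - (- x v)) * (Q\<^sup>2 - 1 - (- x v) - 1)"
      using count[OF v] by simp
    ultimately show False using large_degree_arith[OF Q2(1) k2 _ S] by simp
  qed
  \<comment> \<open>By \<open>max_deg\<close> these classes cover \<open>V\<close>, with deficiency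
    \<open>- 1\<close> on \<open>A\<close>, 0 on \<open>Z\<close> and positive on
    \<open>P\<close>.\<close>
  define A where "A = {v \<in> V. card (nbrs v) = q + 2}"
  define Z where "Z = {v \<in> V. card (nbrs v) = q + 1}"
  define P where "P = {v \<in> V. card (nbrs v) \<le> q}"
  define a where "a = int (card A)"
  define p where "p = int (card P)"
  define e where "e = (\<Sum>v\<in>A. int (card (nbrs v \<inter> P)))"
  have sub: "A \<subseteq> V" "Z \<subseteq> V" "P \<subseteq> V" by (auto simp: A_def Z_def P_def)
  have fin: "finite A" "finite Z" "finite P" using finite_V by (simp_all add: A_def Z_def P_def)
  have VAZP: "V = (A \<union> Z) \<union> P" using max_deg by (force simp: A_def Z_def P_def)
  have disj: "A \<inter> Z = {}" "(A \<union> Z) \<inter> P = {}" by (auto simp: A_def Z_def P_def)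
  have split: "(\<Sum>v\<in>V. f v) = (\<Sum>v\<in>A. f v) + (\<Sum>v\<in>Z. f v) + (\<Sum>v\<in>P. f v)" for f :: "'a \<Rightarrow> int"
    using fin disj by (subst VAZP) (simp add: sum.union_disjoint)
  have xA: "x v = - 1" if "v \<in> A" for v using that by (simp add: A_def x_def)
  have xZ: "x v = 0" if "v \<in> Z" for v using that by (simp add: Z_def x_def)
  have xP: "1 \<le> x v" if "v \<in> P" for v using that by (simp add: P_def x_def)
  have cardZ: "int (card Z) = Q\<^sup>2 + Q - a - p"
    using split[of "\<lambda>_. 1"] by (simp add: n a_def p_def)
  have T: "(\<Sum>v\<in>P. x v) = S + a"
    using split[of x] xA xZ by (simp add: S_def a_def)
  have pT: "p \<le> S + a"
    using sum_mono[of P "\<lambda>_. 1" x] xP T by (simp add: p_def)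
  have nbr_x: "Q * int (card (nbrs v)) - Q\<^sup>2 - Q + 1 + (if odd (card (nbrs v)) then 1 else 0)
      \<le> (\<Sum>u\<in>nbrs v. x u)" if "v \<in> V" for v
    using sum_nbr_degrees_le[OF that] n
    by (simp add: x_def sum_subtractf Q_def algebra_simps split: if_splits)
  \<comment> \<open>The weights are \<open>nbr_x\<close> at the degrees \<open>q + 1\<close>, which
    is odd and gains the parity term, and \<open>q + 2\<close>, which is even.\<close>
  have lower: "2 * int (card Z) + (Q + 1) * a \<le> (\<Sum>v\<in>A \<union> Z. \<Sum>u\<in>nbrs v \<inter> V. x u)"
  proof -
    have "Q + 1 \<le> (\<Sum>u\<in>nbrs v \<inter> V. x u)" if "v \<in> A" for v
      using that nbr_x[of v] nbrs_sub[of v] q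
      by (simp add: A_def Q_def Int_absorb2 algebra_simps power2_eq_square)
    then have "(Q + 1) * a \<le> (\<Sum>v\<in>A. \<Sum>u\<in>nbrs v \<inter> V. x u)"
      using sum_mono[of A "\<lambda>_. Q + 1" "\<lambda>v. \<Sum>u\<in>nbrs v \<inter> V. x u"] by (simp add: a_def mult.commute)
    moreover have "2 \<le> (\<Sum>u\<in>nbrs v \<inter> V. x u)" if "v \<in> Z" for v
      using that nbr_x[of v] nbrs_sub[of v] q
      by (simp add: Z_def Q_def Int_absorb2 algebra_simps power2_eq_square)
    then have "2 * int (card Z) \<le> (\<Sum>v\<in>Z. \<Sum>u\<in>nbrs v \<inter> V. x u)"
      using sum_mono[of Z "\<lambda>_. 2" "\<lambda>v. \<Sum>u\<in>nbrs v \<inter> V. x u"] by (simp add: mult.commute)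
    ultimately show ?thesis using fin disj by (simp add: sum.union_disjoint)
  qed
  \<comment> \<open>The same sum taken by the neighbour \<open>u\<close>: on \<open>A\<close> the
    multiplicity is known exactly in terms of edges to \<open>P\<close>, on \<open>Z\<close> the
    deficiency vanishes, and on \<open>P\<close> the multiplicity is at most the degree.\<close>
  have upper: "(\<Sum>v\<in>A \<union> Z. \<Sum>u\<in>nbrs v \<inter> V. x u) \<le> Q * (S + a) - (Q + 2) * a + e"
  proof -
    define d where "d u = int (card (nbrs u \<inter> (A \<union> Z)))" for u
    have "(\<Sum>v\<in>A \<union> Z. \<Sum>u\<in>nbrs v \<inter> V. x u) = (\<Sum>u\<in>V. d u * x u)"
      unfolding d_def using sub by (intro sum_nbrs_swap) auto
    also have "\<dots> = (\<Sum>u\<in>A. d u * x u) + (\<Sum>u\<in>P. d u * x u)"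
      using split[of "\<lambda>u. d u * x u"] xZ by simp
    also have "(\<Sum>u\<in>A. d u * x u) = (\<Sum>u\<in>A. int (card (nbrs u \<inter> P)) - (Q + 2))"
    proof (rule sum.cong)
      fix u assume u: "u \<in> A"
      have "nbrs u = (nbrs u \<inter> (A \<union> Z)) \<union> (nbrs u \<inter> P)"
        using VAZP nbrs_sub by blast
      moreover have "card ((nbrs u \<inter> (A \<union> Z)) \<union> (nbrs u \<inter> P))
          = card (nbrs u \<inter> (A \<union> Z)) + card (nbrs u \<inter> P)"
        using disj finite_nbrs by (intro card_Un_disjoint) auto
      ultimately have "card (nbrs u) = card (nbrs u \<inter> (A \<union> Z)) + card (nbrs u \<inter> P)"
        by simp
      then show "d u * x u = int (card (nbrs u \<inter> P)) - (Q + 2)"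
        using u xA by (simp add: d_def A_def Q_def)
    qed simp
    also have "\<dots> = e - (Q + 2) * a"
      by (simp add: e_def a_def sum_subtractf)
    also have "(\<Sum>u\<in>P. d u * x u) \<le> (\<Sum>u\<in>P. Q * x u)"
    proof (rule sum_mono)
      fix u assume u: "u \<in> P"
      have "card (nbrs u \<inter> (A \<union> Z)) \<le> card (nbrs u)"
        using finite_nbrs by (intro card_mono) auto
      then have "d u \<le> Q" using u by (simp add: d_def P_def Q_def)
      then show "d u * x u \<le> Q * x u" using xP[OF u] by (simp add: mult_right_mono)
    qed
    also have "\<dots> = Q * (S + a)" by (simp add: sum_distrib_left[symmetric] T)
    finally show ?thesis by simp
  qed
  \<comment> \<open>The constant 4 is
    \<open>2 * Q\<^sup>2 + 2 * Q - (Q + 2) * (2 * Q - 2)\<close>.\<close>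
  have e_ge: "(Q - 1) * a + 4 \<le> e"
  proof -
    have "(Q + 2) * S \<le> (Q + 2) * (2 * Q - 2)"
      using S Q2 by (intro mult_left_mono) auto
    then show ?thesis
      using lower upper cardZ pT by (simp add: algebra_simps power2_eq_square)
  qed
  have e_le: "e \<le> (Q + 2) * a"
  proof -
    have "int (card (nbrs v \<inter> P)) \<le> Q + 2" if "v \<in> A" for v
    proof -
      have "card (nbrs v \<inter> P) \<le> card (nbrs v)" using finite_nbrs by (intro card_mono) auto
      then show ?thesis using that by (simp add: A_def Q_def)
    qed
    then show ?thesis
      using sum_mono[of A "\<lambda>v. int (card (nbrs v \<inter> P))" "\<lambda>_. Q + 2"]
      by (simp add: e_def a_def mult.commute)
  qed
  \<comment> \<open>Pairs in \<open>A\<close> with a common neighbour in \<open>P\<close>, where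
    \<open>(c u - 1) * (c u - 2) \<ge> 0\<close> makes the count linear.\<close>
  have pairs_A: "2 * e \<le> 2 * p + a * (a - 1)"
  proof -
    define c where "c u = int (card (nbrs u \<inter> A))" for u
    have "(\<Sum>u\<in>P. c u * (c u - 1)) \<le> a * (a - 1)"
      unfolding c_def a_def using fin common_nbr_unique
      by (intro sum_ordered_pairs_le) auto
    moreover have "(\<Sum>u\<in>P. 2 * c u - 2) \<le> (\<Sum>u\<in>P. c u * (c u - 1))"
    proof (rule sum_mono)
      fix u
      show "2 * c u - 2 \<le> c u * (c u - 1)"
        using int_mult_succ_nonneg[of "c u - 2"] by (simp add: algebra_simps)
    qed
    moreover have "e = (\<Sum>u\<in>P. c u)"
      unfolding e_def c_def using sub by (intro card_nbrs_swap)
    ultimately show ?thesis by (simp add: sum_subtractf sum_distrib_left[symmetric] p_def)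
  qed
  \<comment> \<open>The roles are exchanged; the minorant is exact at \<open>Q - 1\<close> and
    \<open>Q\<close>, since \<open>e_ge\<close> puts the mean of \<open>c\<close> above
    \<open>Q - 1\<close>.\<close>
  have pairs_P: "a * ((Q - 1) * (Q - 2)) + 2 * (Q - 1) * (e - (Q - 1) * a) \<le> p * (p - 1)"
  proof -
    define c where "c v = int (card (nbrs v \<inter> P))" for v
    have "(\<Sum>v\<in>A. c v * (c v - 1)) \<le> p * (p - 1)"
      unfolding c_def p_def using fin common_nbr_unique
      by (intro sum_ordered_pairs_le) auto
    moreover have "(\<Sum>v\<in>A. (Q - 1) * (Q - 2) + 2 * (Q - 1) * (c v - (Q - 1)))
        \<le> (\<Sum>v\<in>A. c v * (c v - 1))"
    proof (rule sum_mono)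
      fix v
      show "(Q - 1) * (Q - 2) + 2 * (Q - 1) * (c v - (Q - 1)) \<le> c v * (c v - 1)"
        using int_mult_succ_nonneg[of "c v - Q"] by (simp add: algebra_simps)
    qed
    moreover have "(\<Sum>v\<in>A. (Q - 1) * (Q - 2) + 2 * (Q - 1) * (c v - (Q - 1)))
        = a * ((Q - 1) * (Q - 2)) + 2 * (Q - 1) * (e - (Q - 1) * a)"
      by (simp add: sum.distrib sum_subtractf sum_distrib_left[symmetric] e_def c_def a_def
          mult.commute)
    ultimately show ?thesis by simp
  qed
  \<comment> \<open>The pair count at a vertex of \<open>A\<close>, where the other
    \<open>a - 1\<close> vertices of \<open>A\<close> each contribute the extra 2.\<close>
  have a_le: "2 * (a - 1) \<le> Q\<^sup>2 - 7 * Q + 8" if "1 \<le> a"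
  proof -
    obtain v where v: "v \<in> A" using \<open>1 \<le> a\<close> by (force simp: a_def)
    have "{w \<in> V - {v}. card (nbrs w) = q + 2} = A - {v}" by (auto simp: A_def)
    moreover have "int (card (A - {v})) = a - 1"
      using v fin by (metis a_def card.remove of_nat_Suc add_diff_cancel_left')
    ultimately have "(Q\<^sup>2 + Q - 1) * (Q * (Q - 1)) - 2 * (Q - 1) * (S + 1) + 2 * (a - 1)
        \<le> (Q\<^sup>2 - 2) * (Q\<^sup>2 - 3)"
      using count[of v] v sub xA[OF v] by auto
    moreover have "(Q - 1) * (S + 1) \<le> (Q - 1) * (2 * Q - 1)"
      using S Q2 by (intro mult_left_mono) auto
    ultimately have "(Q\<^sup>2 + Q - 1) * (Q * (Q - 1)) - 2 * (Q - 1) * (2 * Q - 1) + 2 * (a - 1)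
        \<le> (Q\<^sup>2 - 2) * (Q\<^sup>2 - 3)"
      by linarith
    then show ?thesis by (simp add: algebra_simps power2_eq_square)
  qed
  have "p \<le> a + 2 * Q - 2" "0 \<le> a" "0 \<le> p" using pT S by (auto simp: a_def p_def)
  then show False
    using degree_class_arith[OF Q2 _ _ _ e_ge e_le pairs_A a_le pairs_P] by simp
qed

section \<open>From the deficiency to the number of edges\<close>

text \<open>The total deficiency is \<open>q * (q + 1)\<^sup>2 - 2 * card E\<close>. It is even and
  exceeds \<open>2 * q - 2\<close>, so it is at least \<open>2 * q\<close>.\<close>

lemma card_edges_le:
  fixes q :: nat
  assumes q: "0 < q" "even q" and cardV: "card V = q\<^sup>2 + q"
  shows "real (card E) \<le> 1 / 2 * real q * (real q + 1)\<^sup>2 - real q"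
proof -
  have "{e \<in> E. e \<subseteq> V} = E" using edge by auto
  then have "(\<Sum>v\<in>V. int (card (nbrs v))) = 2 * int (card E)"
    using handshake[of V] nbrs_sub by (simp add: Int_absorb2 flip: of_nat_sum)
  then have "2 * int q - 2 < (int q + 1) * (int q * (int q + 1)) - 2 * int (card E)"
    using deficiency_gt[OF assms] cardV
    by (simp add: sum_subtractf algebra_simps power2_eq_square)
  moreover obtain r where r: "int q = 2 * r" using q by (metis evenE even_of_nat)
  ultimately have "2 * (2 * r - 1) < 2 * ((2 * r + 1) * (r * (2 * r + 1)) - int (card E))"
    by (simp add: algebra_simps)
  then have "int (card E) \<le> (2 * r + 1) * (r * (2 * r + 1)) - 2 * r"
    by (subst (asm) mult_less_cancel_left_pos) simp_all
  then have "real_of_int (int (card E)) \<le> real_of_int ((2 * r + 1) * (r * (2 * r + 1)) - 2 * r)"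
    by (rule of_int_le_iff[THEN iffD2])
  moreover have "real q = 2 * real_of_int r" using r by (metis of_int_mult of_int_numeral of_int_of_nat_eq)
  ultimately show ?thesis by (simp add: power2_eq_square algebra_simps)
qed

end

text \<open>An edge in \<open>H\<close> makes the edgeless graph \<open>H\<close>-free, so the
  maximum ranges over a nonempty finite set.\<close>

lemma ex_attained:
  assumes "snd H \<noteq> {}"
  shows "\<exists>E. ex n H = card E \<and> simple_graph ({..<n}, E) \<and> \<not> contains_subgraph ({..<n}, E) H"
proof -
  define G where "G = {E. simple_graph ({..<n}, E) \<and> \<not> contains_subgraph ({..<n}, E) H}"
  have "G \<subseteq> Pow (Pow {..<n})" by (auto simp: G_def simple_graph_def)
  then have "finite G" by (rule finite_subset) simp
  moreover have "{} \<in> G" using assms by (auto simp: G_def simple_graph_def contains_subgraph_def)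
  ultimately have "Max (card ` G) \<in> card ` G" by (intro Max_in) auto
  moreover have "ex n H = Max (card ` G)" by (simp add: ex_def G_def image_Collect)
  ultimately show ?thesis by (auto simp: G_def)
qed

theorem theorem1:
  fixes q :: nat
  assumes "q > 0" and "even q"
  shows "real (ex (q\<^sup>2 + q) (cycle_graph 4)) \<le> 1 / 2 * real q * (real q + 1)\<^sup>2 - real q
    \<and> (\<forall>V (E :: 'a set set).
          simple_graph (V, E) \<longrightarrow> card V = q\<^sup>2 + q \<longrightarrow> \<not> contains_subgraph (V, E) (cycle_graph 4)
          \<longrightarrow> real (card E) \<le> 1 / 2 * real q * (real q + 1)\<^sup>2 - real q)"
proof (intro conjI allI impI)
  have "{0, Suc 0 mod 4} \<in> snd (cycle_graph 4)" by (force simp: cycle_graph_def)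
  then have "snd (cycle_graph 4) \<noteq> {}" by blast
  then obtain E where "ex (q\<^sup>2 + q) (cycle_graph 4) = card E"
    and "C4_free_graph {..<q\<^sup>2 + q} E"
    using ex_attained unfolding C4_free_graph_def by blast
  then show "real (ex (q\<^sup>2 + q) (cycle_graph 4)) \<le> 1 / 2 * real q * (real q + 1)\<^sup>2 - real q"
    using C4_free_graph.card_edges_le assms by (metis card_lessThan)
next
  fix V and E :: "'a set set"
  assume "simple_graph (V, E)" "card V = q\<^sup>2 + q" "\<not> contains_subgraph (V, E) (cycle_graph 4)"
  then show "real (card E) \<le> 1 / 2 * real q * (real q + 1)\<^sup>2 - real q"
    using C4_free_graph.card_edges_le[OF C4_free_graph.intro] assms by blast
qed

end
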